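(* Let $\mathcal{W}$ be the set of Weihrauch degrees (the degree $\mathbf{0}$ together with the degrees of all multi-valued functions, between represented spaces in the fixed set $\mathcal{R}$, having at least one computable point in their domain), partially ordered by Weihrauch reducibility $\leq_{\mathrm W}$. Then $(\mathcal{W},\leq_{\mathrm W})$ is a lower semi-lattice with least element $\mathbf{1}$ and greatest element $\mathbf{0}$ and with the direct sum $\oplus$ as the greatest lower bound operation. In particular, $(\mathcal{W},\oplus)$ is an idempotent monoid with neutral element $\mathbf{0}$. Moreover, $(\mathcal{W},\times)$ is a monoid with neutral element $\mathbf{1}$.
   Context: A represented space $(X,\delta_X)$ is a set $X$ with a surjective partial map $\delta_X:\subseteq\mathbb{N}^{\mathbb{N}}\to X$; $x\in X$ is computable if $x=\delta_X(p)$ for some computable $p$. A multi-valued function $f:\subseteq X\rightrightarrows Y$ assigns to each $x$ a set $f(x)\subseteq Y$, with $\mathrm{dom}(f)=\{x: f(x)\neq\emptyset\}$. A realizer of $f$ (written $F\vdash f$) is a partial function $F:\subseteq\mathbb{N}^{\mathbb{N}}\to\mathbb{N}^{\mathbb{N}}$ such that $F(p)$ is defined and $\delta_YF(p)\in f(\delta_X(p))$ for all $p$ with $\delta_X(p)\in\mathrm{dom}(f)$. $f$ is computable if it has a computable realizer. Let $\langle\cdot,\cdot\rangle$ be a computable standard pairing function on $\mathbb{N}^{\mathbb{N}}$. Weihrauch reducibility: $f\leq_{\mathrm W}g$ iff there are computable $H,K:\subseteq\mathbb{N}^{\mathbb{N}}\to\mathbb{N}^{\mathbb{N}}$ such that for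 every realizer $G$ of $g$ the function $p\mapsto H\langle p,GK(p)\rangle$ is a realizer of $f$. This is a preorder; $f\equiv_{\mathrm W}g$ means $f\leq_{\mathrm W}g$ and $g\leq_{\mathrm W}f$, and Weihrauch degrees are the equivalence classes. Product: for $f:\subseteq X\rightrightarrows Y$, $g:\subseteq U\rightrightarrows V$, $f\times g:\subseteq X\times U\rightrightarrows Y\times V$, $(f\times g)(x,u)=f(x)\times g(u)$, with domain $\mathrm{dom}(f)\times\mathrm{dom}(g)$. Products carry the representation $[\delta_X,\delta_U]\langle p,q\rangle=(\delta_X(p),\delta_U(q))$. Direct sum: $f\oplus g:\subseteq X\times U\rightrightarrows Y\oplus V$, where $Y\oplus V=(\{0\}\times Y)\cup(\{1\}\times V)$, $(f\oplus g)(x,u)=(\{0\}\times f(x))\cup(\{1\}\times g(u))$, with domain $\mathrm{dom}(f)\times\mathrm{dom}(g)$. $Y\oplus V$ is represented by: $np$ (the sequence $p$ prefixed by $n\in\mathbb{N}$) names $(0,\delta_Y(p))$ if $n=0$ and $(1,\delta_V(p))$ otherwise. $\mathcal{R}$ is a fixed set of represented spaces that contains $(\mathbb{N}^{\mathbb{N}},\mathrm{id})$ and is closed under products and direct sums. An extra object $\boldsymbol{\emptyset}$ is added whose set of realizers is declared to be empty; $\leq_{\mathrm W}$ is extended to it by the same definition, and $\mathbf{0}$ denotes its degree. $\mathcal{W}$ is the set consisting of $\mathbf{0}$ and all Weihrauch degrees of multi-valued functions $f:\subseteq X\rightrightarrows Y$ with $X,Y\in\mathcal{R}$ and at least one computable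 point in $\mathrm{dom}(f)$. $\mathbf{1}$ denotes the degree of the computable functions in $\mathcal{W}$. The operations $\oplus,\times$ on degrees are induced by those on functions; for $\mathbf{0}$ one uses $a\oplus\mathbf{0}=\mathbf{0}\oplus a=a$ and $a\times\mathbf{0}=\mathbf{0}\times a=\mathbf{0}$. *)

theory Defs
  imports "HOL-Algebra.Group"
begin

section \<open>Computability on Baire space\<close>

type_synonym baire = "nat \<Rightarrow> nat"

text \<open>
  Kleene's partial recursive functions relative to a function \<open>p\<close>. The program \<open>Oracle\<close> returns
  \<open>p n\<close> on argument \<open>n\<close>. In \<open>PrimRec\<close> the recursion argument comes first and the step function
  receives the counter, the previous value and the parameters, in this order; \<open>Mu\<close> searches for
  its first argument.
\<close>

datatype prog =
    Zero
  | Succ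
  | Proj nat
  | Oracle
  | Comp prog "prog list"
  | PrimRec prog prog
  | Mu prog

inductive eval :: "baire \<Rightarrow> prog \<Rightarrow> nat list \<Rightarrow> nat \<Rightarrow> bool" for p :: baire where
  eval_Zero: "eval p Zero xs 0"
| eval_Succ: "eval p Succ [n] (Suc n)"
| eval_Proj: "i < length xs \<Longrightarrow> eval p (Proj i) xs (xs ! i)"
| eval_Oracle: "eval p Oracle [n] (p n)"
| eval_Comp: "\<lbrakk>length vs = length gs; \<forall>i < length gs. eval p (gs ! i) xs (vs ! i); eval p f vs y\<rbrakk>
    \<Longrightarrow> eval p (Comp f gs) xs y"
| eval_PrimRec_0: "eval p g xs y \<Longrightarrow> eval p (PrimRec g h) (0 # xs) y"
| eval_PrimRec_Suc: "\<lbrakk>eval p (PrimRec g h) (n # xs) z; eval p h (n # z # xs) y\<rbrakk>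
    \<Longrightarrow> eval p (PrimRec g h) (Suc n # xs) y"
| eval_Mu: "\<lbrakk>eval p f (n # xs) 0; \<forall>m < n. \<exists>v > 0. eval p f (m # xs) v\<rbrakk>
    \<Longrightarrow> eval p (Mu f) xs n"

fun oracle_free :: "prog \<Rightarrow> bool" where
  "oracle_free Zero = True"
| "oracle_free Succ = True"
| "oracle_free (Proj i) = True"
| "oracle_free Oracle = False"
| "oracle_free (Comp f gs) = (oracle_free f \<and> (\<forall>g \<in> set gs. oracle_free g))"
| "oracle_free (PrimRec g h) = (oracle_free g \<and> oracle_free h)"
| "oracle_free (Mu f) = oracle_free f"

text \<open>A point of Baire space is computable if it is a total recursive function; the
  function supplied to a program without \<open>Oracle\<close> is irrelevant.\<close>

definition computable_point :: "baire \<Rightarrow> bool" where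
  "computable_point q \<longleftrightarrow> (\<exists>e. oracle_free e \<and> (\<forall>p n. eval p e [n] (q n)))"

text \<open>A partial function on Baire space is computable if one program computes it on its domain,
  with no condition on the behaviour of the program elsewhere. If one also asks the program to
  compute an infinite output only on the domain, the notions below do not change, because
  every extension of a realizer is a realizer.\<close>

definition computable_fun :: "(baire \<rightharpoonup> baire) \<Rightarrow> bool" where
  "computable_fun F \<longleftrightarrow> (\<exists>e. \<forall>p q. F p = Some q \<longrightarrow> (\<forall>n. eval p e [n] (q n)))"

definition bpair :: "baire \<Rightarrow> baire \<Rightarrow> baire" where
  "bpair p q = (\<lambda>n. if even n then p (n div 2) else q (n div 2))"

definition bfst :: "baire \<Rightarrow> baire" where
  "bfst r = (\<lambda>n. r (2 * n))"

definition bsnd :: "baire \<Rightarrow> baire" where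
  "bsnd r = (\<lambda>n. r (2 * n + 1))"

lemma bfst_bpair [simp]: "bfst (bpair p q) = p"
  by (simp add: bfst_def bpair_def)

lemma bsnd_bpair [simp]: "bsnd (bpair p q) = q"
  by (simp add: bsnd_def bpair_def)

lemma bpair_bfst_bsnd [simp]: "bpair (bfst r) (bsnd r) = r"
  by (rule ext) (auto simp: bpair_def bfst_def bsnd_def)


section \<open>Represented spaces and multi-valued functions\<close>

record 'x repspace =
  points :: "'x set"
  rep :: "baire \<rightharpoonup> 'x"

definition represented_space :: "'x repspace \<Rightarrow> bool" where
  "represented_space X \<longleftrightarrow> ran (rep X) = points X"

definition computable_element :: "'x repspace \<Rightarrow> 'x \<Rightarrow> bool" where
  "computable_element X x \<longleftrightarrow> (\<exists>p. computable_point p \<and> rep X p = Some x)"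

record 'x mvf =
  source :: "'x repspace"
  target :: "'x repspace"
  app :: "'x \<Rightarrow> 'x set"

definition mdom :: "'x mvf \<Rightarrow> 'x set" where
  "mdom f = {x. app f x \<noteq> {}}"

text \<open>The multi-valued functions between spaces in \<open>R\<close>. The map is empty outside the source, so
  that \<open>mdom f \<subseteq> points (source f)\<close>.\<close>

definition mvfs :: "'x repspace set \<Rightarrow> 'x mvf set" where
  "mvfs R = {f. source f \<in> R \<and> target f \<in> R
      \<and> (\<forall>x \<in> points (source f). app f x \<subseteq> points (target f))
      \<and> (\<forall>x. x \<notin> points (source f) \<longrightarrow> app f x = {})}"

definition realizer :: "(baire \<rightharpoonup> baire) \<Rightarrow> 'x mvf \<Rightarrow> bool" where
  "realizer F f \<longleftrightarrow> (\<forall>p x. rep (source f) p = Some x \<and> x \<in> mdom f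
      \<longrightarrow> (\<exists>q y. F p = Some q \<and> rep (target f) q = Some y \<and> y \<in> app f x))"

definition computable_mvf :: "'x mvf \<Rightarrow> bool" where
  "computable_mvf f \<longleftrightarrow> (\<exists>F. computable_fun F \<and> realizer F f)"

definition has_computable_point :: "'x mvf \<Rightarrow> bool" where
  "has_computable_point f \<longleftrightarrow> (\<exists>x \<in> mdom f. computable_element (source f) x)"


section \<open>A universe closed under pairs\<close>

text \<open>
  All spaces of the fixed set of represented spaces live over one type, which therefore has to
  contain the points of Baire space, ordered pairs and the tags 0 and 1 of direct sums. The type
  parameter is arbitrary and provides the points of all other spaces.
\<close>

datatype 'a obj =
    Atom 'a
  | Num nat
  | Seq baire
  | Tup "'a obj" "'a obj"

definition baire_space :: "'a obj repspace" where
  "baire_space = \<lparr>points = range Seq, rep = (\<lambda>p. Some (Seq p))\<rparr>"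

definition prod_space :: "'a obj repspace \<Rightarrow> 'a obj repspace \<Rightarrow> 'a obj repspace" where
  "prod_space X U =
    \<lparr>points = {Tup x u |x u. x \<in> points X \<and> u \<in> points U},
     rep = (\<lambda>r. case (rep X (bfst r), rep U (bsnd r)) of
              (Some x, Some u) \<Rightarrow> Some (Tup x u)
            | _ \<Rightarrow> None)\<rparr>"

definition sum_space :: "'a obj repspace \<Rightarrow> 'a obj repspace \<Rightarrow> 'a obj repspace" where
  "sum_space Y V =
    \<lparr>points = Tup (Num 0) ` points Y \<union> Tup (Num 1) ` points V,
     rep = (\<lambda>r. let n = r 0; p = (\<lambda>i. r (Suc i)) in
              if n = 0 then map_option (Tup (Num 0)) (rep Y p)
              else map_option (Tup (Num 1)) (rep V p))\<rparr>"

definition mvf_prod :: "'a obj mvf \<Rightarrow> 'a obj mvf \<Rightarrow> 'a obj mvf" where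
  "mvf_prod f g =
    \<lparr>source = prod_space (source f) (source g),
     target = prod_space (target f) (target g),
     app = (\<lambda>z. {Tup y v |y v. \<exists>x u. z = Tup x u \<and> y \<in> app f x \<and> v \<in> app g u})\<rparr>"

definition mvf_sum :: "'a obj mvf \<Rightarrow> 'a obj mvf \<Rightarrow> 'a obj mvf" where
  "mvf_sum f g =
    \<lparr>source = prod_space (source f) (source g),
     target = sum_space (target f) (target g),
     app = (\<lambda>z. case z of
              Tup x u \<Rightarrow> if x \<in> mdom f \<and> u \<in> mdom g
                then Tup (Num 0) ` app f x \<union> Tup (Num 1) ` app g u else {}
            | _ \<Rightarrow> {})\<rparr>"


section \<open>Weihrauch reducibility and degrees\<close>

text \<open>\<open>NoRealizer\<close> is the additional object that is declared to have no realizer.\<close>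

datatype 'x problem = NoRealizer | Mvf "'x mvf"

fun realizer_set :: "'x problem \<Rightarrow> (baire \<rightharpoonup> baire) set" where
  "realizer_set NoRealizer = {}"
| "realizer_set (Mvf f) = {F. realizer F f}"

definition weihrauch_le :: "'x problem \<Rightarrow> 'x problem \<Rightarrow> bool" (infix \<open>\<le>\<^sub>W\<close> 50) where
  "f \<le>\<^sub>W g \<longleftrightarrow> (\<exists>H K. computable_fun H \<and> computable_fun K \<and>
     (\<forall>G \<in> realizer_set g.
        (\<lambda>p. Option.bind (K p) (\<lambda>s. Option.bind (G s) (\<lambda>r. H (bpair p r)))) \<in> realizer_set f))"

definition weihrauch_equiv :: "'x problem \<Rightarrow> 'x problem \<Rightarrow> bool" (infix \<open>\<equiv>\<^sub>W\<close> 50) where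
  "f \<equiv>\<^sub>W g \<longleftrightarrow> f \<le>\<^sub>W g \<and> g \<le>\<^sub>W f"

definition problems :: "'x repspace set \<Rightarrow> 'x problem set" where
  "problems R = insert NoRealizer (Mvf ` mvfs R)"

definition degree :: "'x repspace set \<Rightarrow> 'x problem \<Rightarrow> 'x problem set" where
  "degree R f = {g \<in> problems R. g \<equiv>\<^sub>W f}"

definition zero_degree :: "'x repspace set \<Rightarrow> 'x problem set" where
  "zero_degree R = degree R NoRealizer"

definition degrees :: "'x repspace set \<Rightarrow> 'x problem set set" where
  "degrees R = insert (zero_degree R)
     {degree R (Mvf f) |f. f \<in> mvfs R \<and> has_computable_point f}"

definition one_degree :: "'x repspace set \<Rightarrow> 'x problem set" where
  "one_degree R = {Mvf f |f. f \<in> mvfs R \<and> has_computable_point f \<and> computable_mvf f}"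

fun problem_sum :: "'a obj problem \<Rightarrow> 'a obj problem \<Rightarrow> 'a obj problem" where
  "problem_sum (Mvf f) (Mvf g) = Mvf (mvf_sum f g)"
| "problem_sum f NoRealizer = f"
| "problem_sum NoRealizer g = g"

fun problem_prod :: "'a obj problem \<Rightarrow> 'a obj problem \<Rightarrow> 'a obj problem" where
  "problem_prod (Mvf f) (Mvf g) = Mvf (mvf_prod f g)"
| "problem_prod f NoRealizer = NoRealizer"
| "problem_prod NoRealizer g = NoRealizer"

text \<open>The operations and the order induced on degrees. Each operation collects the degrees of the
  results for all representatives. Since distinct degrees are disjoint and non-empty, the result
  is a degree only if it does not depend on the representatives, so closure of \<open>degrees R\<close> under
  an operation includes its well-definedness.\<close>

definition degree_sum :: "'a obj repspace set \<Rightarrow>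
    'a obj problem set \<Rightarrow> 'a obj problem set \<Rightarrow> 'a obj problem set" where
  "degree_sum R a b = (\<Union>f \<in> a. \<Union>g \<in> b. degree R (problem_sum f g))"

definition degree_prod :: "'a obj repspace set \<Rightarrow>
    'a obj problem set \<Rightarrow> 'a obj problem set \<Rightarrow> 'a obj problem set" where
  "degree_prod R a b = (\<Union>f \<in> a. \<Union>g \<in> b. degree R (problem_prod f g))"

definition degree_le :: "'x problem set \<Rightarrow> 'x problem set \<Rightarrow> bool" where
  "degree_le a b \<longleftrightarrow> (\<exists>f \<in> a. \<exists>g \<in> b. f \<le>\<^sub>W g)"

definition degree_order :: "'x repspace set \<Rightarrow> 'x problem set gorder" where
  "degree_order R = \<lparr>carrier = degrees R, eq = (=), le = degree_le\<rparr>"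

definition sum_monoid :: "'a obj repspace set \<Rightarrow> 'a obj problem set monoid" where
  "sum_monoid R = \<lparr>carrier = degrees R, mult = degree_sum R, one = zero_degree R\<rparr>"

definition prod_monoid :: "'a obj repspace set \<Rightarrow> 'a obj problem set monoid" where
  "prod_monoid R = \<lparr>carrier = degrees R, mult = degree_prod R, one = one_degree R\<rparr>"

end

theory Submission
  imports Defs
begin

text \<open>
  A realizer of a multi-valued function between represented spaces acts on names, so the whole
  question takes place in Baire space. The lemma \<open>weihrauch_le_Mvf_iff\<close> removes the quantifier
  over realizers: if \<open>g\<close> has a realizer, then a pair of computable functions \<open>H\<close> and \<open>K\<close> reduces
  \<open>f\<close> to \<open>g\<close> iff \<open>K\<close> sends names of instances of \<open>f\<close> to names of instances of \<open>g\<close> and \<open>H\<close> turns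
  every correct answer to the query into a correct answer to the original instance. The reason is
  that a realizer may be altered at a single name.

  With this description each law is a matter of rearranging names. The sum \<open>f \<oplus> g\<close> is below \<open>f\<close>
  and \<open>g\<close>, because an answer to one of the two queries only has to be tagged. It is the greatest
  lower bound, because a problem that reduces to both \<open>f\<close> and \<open>g\<close> can ask both queries at once and
  then look at the tag to see which of its two reductions is to be completed. Monotonicity,
  associativity and idempotence of \<open>\<oplus>\<close> are consequences. For the product, two reductions run in
  parallel, and associativity is a regrouping of components.

  The degree \<open>1\<close> is that of the identity of Baire space. A multi-valued function is above the identity
  iff its domain has a computable point: a reduction maps a computable point to a computable query,
  and conversely a fixed computable query gives a reduction. It is below the identity iff it is
  computable. The first fact makes \<open>1\<close> the least element. In a product with the identity, the
  component of the identity is copied from its input, so \<open>1\<close> is also neutral. The degree \<open>0\<close> of the object without realizers is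
  the greatest for trivial reasons. No multi-valued function in question is equivalent to this
  object, because each of them has a realizer: representations are surjective and realizers may be
  chosen freely.

  All this needs a few closure properties of computable functions on Baire space. Composition is the
  substitution of a program for the oracle. The only delicate one is the case distinction, which
  chooses between two partial functions and must not run the program of the function that is not
  selected, while composition of programs evaluates every argument; see \<open>guarded\<close>.
\<close>


section \<open>Computable functions on Baire space\<close>

text \<open>Feeding the output of one oracle program to another: every query is replaced by a run
  of the program that computes the queried point.\<close>

fun replace_oracle :: "prog \<Rightarrow> prog \<Rightarrow> prog" where
  "replace_oracle e Zero = Zero"
| "replace_oracle e Succ = Succ"
| "replace_oracle e (Proj i) = Proj i"
| "replace_oracle e Oracle = e"
| "replace_oracle e (Comp f gs) = Comp (replace_oracle e f) (map (replace_oracle e) gs)"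
| "replace_oracle e (PrimRec g h) = PrimRec (replace_oracle e g) (replace_oracle e h)"
| "replace_oracle e (Mu f) = Mu (replace_oracle e f)"

lemma eval_replace_oracle:
  assumes "eval q f xs y" and "\<And>n. eval p e [n] (q n)"
  shows "eval p (replace_oracle e f) xs y"
  using assms(1)
proof induction
  case (eval_Mu f n xs)
  then show ?case
    by (auto intro!: eval.eval_Mu)
next
  case (eval_Comp vs gs xs f y)
  then show ?case
    by (auto intro!: eval.eval_Comp[where vs = vs])
qed (auto intro: eval.intros assms(2))

lemma oracle_free_replace_oracle:
  "oracle_free e \<Longrightarrow> oracle_free (replace_oracle e f)"
  by (induction f) auto

lemma computable_fun_apply:
  assumes "computable_fun F" and "computable_fun (\<lambda>p. Some (f p))"
  shows "computable_fun (\<lambda>p. F (f p))"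
proof -
  obtain e where e: "\<And>p q n. F p = Some q \<Longrightarrow> eval p e [n] (q n)"
    using assms(1) unfolding computable_fun_def by blast
  obtain d where d: "\<And>p n. eval p d [n] (f p n)"
    using assms(2) unfolding computable_fun_def by blast
  have "\<forall>n. eval p (replace_oracle d e) [n] (q n)" if "F (f p) = Some q" for p q
    using eval_replace_oracle[OF e[OF that]] d by blast
  then show ?thesis
    unfolding computable_fun_def by blast
qed

text \<open>A program without \<open>Oracle\<close> for the argument takes the place of every query, which leaves a
  program without \<open>Oracle\<close> for the value.\<close>

lemma computable_point_image:
  assumes "computable_fun F" and "computable_point p" and "F p = Some q"
  shows "computable_point q"
proof -
  obtain e where e: "\<And>n. eval p e [n] (q n)"
    using assms(1,3) unfolding computable_fun_def by blast
  obtain d where d: "oracle_free d" "\<And>r n. eval r d [n] (p n)"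
    using assms(2) unfolding computable_point_def by blast
  then show ?thesis
    unfolding computable_point_def
    using eval_replace_oracle[OF e] oracle_free_replace_oracle[OF d(1)] by blast
qed

lemma computable_fun_const: "computable_point q \<Longrightarrow> computable_fun (\<lambda>_. Some q)"
  unfolding computable_point_def computable_fun_def by fastforce

lemma computable_point_zero: "computable_point (\<lambda>_. 0)"
  unfolding computable_point_def by (intro exI[of _ Zero]) (simp add: eval_Zero)

lemma computable_fun_id: "computable_fun Some"
  unfolding computable_fun_def by (intro exI[of _ Oracle]) (auto intro: eval_Oracle)

lemma eval_Proj_eq: "i < length xs \<Longrightarrow> y = xs ! i \<Longrightarrow> eval p (Proj i) xs y"
  by (simp add: eval_Proj)

lemma eval_Comp_1:
  "eval p g xs v \<Longrightarrow> eval p f [v] y \<Longrightarrow> eval p (Comp f [g]) xs y"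
  by (rule eval_Comp[where vs = "[v]"]) auto

lemma eval_Comp_2:
  "eval p g xs v \<Longrightarrow> eval p h xs w \<Longrightarrow> eval p f [v, w] y \<Longrightarrow> eval p (Comp f [g, h]) xs y"
  by (rule eval_Comp[where vs = "[v, w]"]) (auto simp: less_Suc_eq)

lemma eval_Comp_3:
  "eval p g xs v \<Longrightarrow> eval p h xs w \<Longrightarrow> eval p k xs z \<Longrightarrow> eval p f [v, w, z] y
    \<Longrightarrow> eval p (Comp f [g, h, k]) xs y"
  by (rule eval_Comp[where vs = "[v, w, z]"]) (auto simp: less_Suc_eq)

definition one_prog :: prog where
  "one_prog = Comp Succ [Zero]"

lemma eval_one_prog: "eval p one_prog xs 1"
  unfolding one_prog_def using eval_Comp_1[OF eval_Zero eval_Succ, of p xs] by simp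

text \<open>The case distinction on a number, by a recursion whose step ignores the previous value.
  Composition evaluates all its arguments, so both alternatives have to terminate.\<close>

definition choose_prog :: prog where
  "choose_prog = PrimRec (Proj 0) (Proj 3)"

lemma eval_choose_prog: "eval p choose_prog [c, a, b] (if c = 0 then a else b)"
proof (induction c)
  case 0
  then show ?case
    unfolding choose_prog_def by (auto intro!: eval_PrimRec_0 eval_Proj_eq)
next
  case (Suc c)
  then show ?case
    unfolding choose_prog_def by (auto intro!: eval_PrimRec_Suc eval_Proj_eq)
qed

lemma eval_choice:
  assumes "eval p c xs k" and "eval p f xs v" and "eval p g xs w"
    and "y = (if k = 0 then v else w)"
  shows "eval p (Comp choose_prog [c, f, g]) xs y"
  unfolding assms(4) by (rule eval_Comp_3[OF assms(1-3) eval_choose_prog])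

definition double_prog :: prog where
  "double_prog = PrimRec Zero (Comp Succ [Comp Succ [Proj 1]])"

lemma eval_double_prog: "eval p double_prog [n] (2 * n)"
proof (induction n)
  case 0
  then show ?case
    unfolding double_prog_def by (auto intro: eval_PrimRec_0 eval_Zero)
next
  case (Suc n)
  have "eval p (Comp Succ [Comp Succ [Proj 1]]) [n, 2 * n] (Suc (Suc (2 * n)))"
    by (rule eval_Comp_1[OF eval_Comp_1[OF eval_Proj_eq[OF _ refl] eval_Succ]])
      (auto intro: eval_Succ)
  with Suc show ?case
    unfolding double_prog_def by (auto intro: eval_PrimRec_Suc)
qed

definition parity_prog :: prog where
  "parity_prog = PrimRec Zero (Comp choose_prog [Proj 1, one_prog, Zero])"

lemma eval_parity_prog: "eval p parity_prog [n] (n mod 2)"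
proof (induction n)
  case 0
  then show ?case
    unfolding parity_prog_def by (auto intro: eval_PrimRec_0 eval_Zero)
next
  case (Suc n)
  have "eval p (Comp choose_prog [Proj 1, one_prog, Zero]) [n, n mod 2] (Suc n mod 2)"
    by (rule eval_choice[OF eval_Proj_eq[OF _ refl] eval_one_prog eval_Zero])
      (auto simp: mod_Suc)
  with Suc show ?case
    unfolding parity_prog_def by (auto intro: eval_PrimRec_Suc)
qed

definition half_prog :: prog where
  "half_prog =
    PrimRec Zero (Comp choose_prog [Comp parity_prog [Proj 0], Proj 1, Comp Succ [Proj 1]])"

lemma eval_half_prog: "eval p half_prog [n] (n div 2)"
proof (induction n)
  case 0
  then show ?case
    unfolding half_prog_def by (auto intro: eval_PrimRec_0 eval_Zero)
next
  case (Suc n)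
  have "eval p (Comp choose_prog [Comp parity_prog [Proj 0], Proj 1, Comp Succ [Proj 1]])
      [n, n div 2] (Suc n div 2)"
    by (rule eval_choice[OF eval_Comp_1[OF eval_Proj_eq[OF _ refl] eval_parity_prog]
          eval_Proj_eq[OF _ refl] eval_Comp_1[OF eval_Proj_eq[OF _ refl] eval_Succ]])
      (auto simp: div_Suc mod_Suc)
  with Suc show ?case
    unfolding half_prog_def by (auto intro: eval_PrimRec_Suc)
qed

lemma computable_fun_bfst:
  assumes "computable_fun (\<lambda>p. Some (f p))"
  shows "computable_fun (\<lambda>p. Some (bfst (f p)))"
proof -
  have "eval p (Comp Oracle [double_prog]) [n] (bfst p n)" for p n
    unfolding bfst_def by (intro eval_Comp_1[OF eval_double_prog eval_Oracle])
  then have "computable_fun (\<lambda>p. Some (bfst p))"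
    unfolding computable_fun_def by blast
  then show ?thesis
    using assms by (rule computable_fun_apply)
qed

lemma computable_fun_bsnd:
  assumes "computable_fun (\<lambda>p. Some (f p))"
  shows "computable_fun (\<lambda>p. Some (bsnd (f p)))"
proof -
  have "eval p (Comp Oracle [Comp Succ [double_prog]]) [n] (bsnd p n)" for p n
    using eval_Comp_1[OF eval_Comp_1[OF eval_double_prog eval_Succ] eval_Oracle, of p n]
    by (simp add: bsnd_def)
  then have "computable_fun (\<lambda>p. Some (bsnd p))"
    unfolding computable_fun_def by blast
  then show ?thesis
    using assms by (rule computable_fun_apply)
qed

lemma computable_fun_bpair:
  assumes "computable_fun (\<lambda>p. Some (f p))" and "computable_fun (\<lambda>p. Some (g p))"
  shows "computable_fun (\<lambda>p. Some (bpair (f p) (g p)))"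
proof -
  obtain d where d: "\<And>p n. eval p d [n] (f p n)"
    using assms(1) unfolding computable_fun_def by blast
  obtain e where e: "\<And>p n. eval p e [n] (g p n)"
    using assms(2) unfolding computable_fun_def by blast
  have "eval p (Comp choose_prog [parity_prog, Comp d [half_prog], Comp e [half_prog]]) [n]
      (bpair (f p) (g p) n)" for p n
    by (rule eval_choice[OF eval_parity_prog eval_Comp_1[OF eval_half_prog d]
          eval_Comp_1[OF eval_half_prog e]])
      (auto simp: bpair_def even_iff_mod_2_eq_zero)
  then show ?thesis
    unfolding computable_fun_def by blast
qed

text \<open>The continuation \<open>G\<close> may use the argument \<open>p\<close> as well as the value of \<open>F\<close>, so it has to be
  computable on pairs. The program for the pair of \<open>p\<close> and the value is correct only where \<open>F\<close>
  is defined, which suffices because the composite is undefined elsewhere.\<close>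

lemma computable_fun_bind:
  assumes "computable_fun F" and "computable_fun (\<lambda>r. G (bfst r) (bsnd r))"
  shows "computable_fun (\<lambda>p. Option.bind (F p) (G p))"
proof -
  obtain d where d: "\<And>p q n. F p = Some q \<Longrightarrow> eval p d [n] (q n)"
    using assms(1) unfolding computable_fun_def by blast
  obtain e where e: "\<And>r q n. G (bfst r) (bsnd r) = Some q \<Longrightarrow> eval r e [n] (q n)"
    using assms(2) unfolding computable_fun_def by blast
  let ?pair = "Comp choose_prog [parity_prog, Comp Oracle [half_prog], Comp d [half_prog]]"
  have "eval p (replace_oracle ?pair e) [n] (q n)"
    if q: "Option.bind (F p) (G p) = Some q" for p q n
  proof -
    obtain s where s: "F p = Some s" "G p s = Some q"
      using q by (cases "F p") auto
    have "eval p ?pair [n] (bpair p s n)" for n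
      by (rule eval_choice[OF eval_parity_prog eval_Comp_1[OF eval_half_prog eval_Oracle]
            eval_Comp_1[OF eval_half_prog d[OF s(1)]]])
        (auto simp: bpair_def even_iff_mod_2_eq_zero)
    moreover have "eval (bpair p s) e [n] (q n)"
      by (rule e) (simp add: s)
    ultimately show ?thesis
      by (blast intro: eval_replace_oracle)
  qed
  then show ?thesis
    unfolding computable_fun_def by blast
qed

text \<open>The pair is the value of a computable function on Baire space with constant components, at
  an arbitrary computable argument.\<close>

lemma computable_point_bpair:
  assumes "computable_point p" and "computable_point q"
  shows "computable_point (bpair p q)"
  by (rule computable_point_image[OF computable_fun_bpair[OF
        computable_fun_const[OF assms(1)] computable_fun_const[OF assms(2)]]
        computable_point_zero refl])

definition btail :: "baire \<Rightarrow> baire" where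
  "btail r = (\<lambda>i. r (Suc i))"

definition bcons :: "nat \<Rightarrow> baire \<Rightarrow> baire" where
  "bcons k p = (\<lambda>n. case n of 0 \<Rightarrow> k | Suc i \<Rightarrow> p i)"

lemma bcons_0 [simp]: "bcons k p 0 = k"
  and btail_bcons [simp]: "btail (bcons k p) = p"
  by (simp_all add: bcons_def btail_def)

lemma computable_fun_btail:
  assumes "computable_fun (\<lambda>p. Some (f p))"
  shows "computable_fun (\<lambda>p. Some (btail (f p)))"
proof -
  have "eval p (Comp Oracle [Succ]) [n] (btail p n)" for p n
    unfolding btail_def by (intro eval_Comp_1[OF eval_Succ eval_Oracle])
  then have "computable_fun (\<lambda>p. Some (btail p))"
    unfolding computable_fun_def by blast
  then show ?thesis
    using assms by (rule computable_fun_apply)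
qed

lemma computable_fun_bcons:
  assumes "\<And>p. eval p e [] k" and "computable_fun (\<lambda>p. Some (f p))"
  shows "computable_fun (\<lambda>p. Some (bcons k (f p)))"
proof -
  have "eval p (PrimRec e (Comp Oracle [Proj 0])) [n] (bcons k p n)" for p n
  proof (induction n)
    case 0
    then show ?case
      using assms(1) by (auto simp: bcons_def intro: eval_PrimRec_0)
  next
    case (Suc n)
    have "eval p (Comp Oracle [Proj 0]) [n, bcons k p n] (p n)"
      by (rule eval_Comp_1[OF eval_Proj_eq[OF _ refl]]) (auto intro: eval_Oracle)
    with Suc show ?case
      by (auto simp: bcons_def intro: eval_PrimRec_Suc)
  qed
  then have "computable_fun (\<lambda>p. Some (bcons k p))"
    unfolding computable_fun_def by blast
  then show ?thesis
    using assms(2) by (rule computable_fun_apply)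
qed

lemmas computable_fun_bcons_0 = computable_fun_bcons[OF eval_Zero]
  and computable_fun_bcons_1 = computable_fun_bcons[OF eval_one_prog]

text \<open>A recursion of length \<open>0\<close> does not evaluate its step, so it can guard a program that need
  not terminate.\<close>

definition guarded :: "prog \<Rightarrow> prog" where
  "guarded e = PrimRec Zero (Comp e [Proj 2])"

lemma eval_guarded_0: "eval p (guarded e) [0, n] 0"
  unfolding guarded_def by (intro eval_PrimRec_0 eval_Zero)

lemma eval_guarded_1:
  assumes "eval p e [n] y"
  shows "eval p (guarded e) [Suc 0, n] y"
proof -
  have "eval p (Comp e [Proj 2]) [0, 0, n] y"
    by (rule eval_Comp_1[OF eval_Proj_eq[OF _ refl]]) (auto simp: assms)
  then show ?thesis
    using eval_PrimRec_Suc[OF eval_guarded_0[unfolded guarded_def]]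
    by (simp add: guarded_def)
qed

text \<open>Only the selected one of \<open>F\<close> and \<open>G\<close> is known to be defined, so each of their programs runs
  under a guard that opens exactly when it is selected.\<close>

lemma computable_fun_if:
  assumes "computable_fun (\<lambda>p. Some (f p))" and "computable_fun F" and "computable_fun G"
  shows "computable_fun (\<lambda>p. if f p 0 = 0 then F p else G p)"
proof -
  obtain c where c: "\<And>p n. eval p c [n] (f p n)"
    using assms(1) unfolding computable_fun_def by blast
  obtain d where d: "\<And>p q n. F p = Some q \<Longrightarrow> eval p d [n] (q n)"
    using assms(2) unfolding computable_fun_def by blast
  obtain e where e: "\<And>p q n. G p = Some q \<Longrightarrow> eval p e [n] (q n)"
    using assms(3) unfolding computable_fun_def by blast
  let ?test = "Comp c [Zero]"
  let ?on0 = "Comp choose_prog [?test, one_prog, Zero]"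
  let ?on1 = "Comp choose_prog [?test, Zero, one_prog]"
  let ?prog = "Comp choose_prog
    [?test, Comp (guarded d) [?on0, Proj 0], Comp (guarded e) [?on1, Proj 0]]"
  have test: "eval p ?test [n] (f p 0)" for p n
    by (rule eval_Comp_1[OF eval_Zero c])
  have on0: "eval p ?on0 [n] (if f p 0 = 0 then 1 else 0)" for p n
    by (rule eval_choice[OF test eval_one_prog eval_Zero refl])
  have on1: "eval p ?on1 [n] (if f p 0 = 0 then 0 else 1)" for p n
    by (rule eval_choice[OF test eval_Zero eval_one_prog refl])
  have arg: "eval p (Proj 0) [n] n" for p n
    by (rule eval_Proj_eq) auto
  have "eval p ?prog [n] (q n)"
    if q: "(if f p 0 = 0 then F p else G p) = Some q" for p q n
  proof (cases "f p 0 = 0")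
    case True
    then have "eval p (Comp (guarded d) [?on0, Proj 0]) [n] (q n)"
      using on0[of p n] q by (auto intro!: eval_Comp_2[OF _ arg] eval_guarded_1 d)
    moreover have "eval p (Comp (guarded e) [?on1, Proj 0]) [n] 0"
      using on1[of p n] True by (auto intro!: eval_Comp_2[OF _ arg] eval_guarded_0)
    ultimately show ?thesis
      using True by (auto intro: eval_choice[OF test])
  next
    case False
    then have "eval p (Comp (guarded e) [?on1, Proj 0]) [n] (q n)"
      using on1[of p n] q by (auto intro!: eval_Comp_2[OF _ arg] eval_guarded_1 e)
    moreover have "eval p (Comp (guarded d) [?on0, Proj 0]) [n] 0"
      using on0[of p n] False by (auto intro!: eval_Comp_2[OF _ arg] eval_guarded_0)
    ultimately show ?thesis
      using False by (auto intro: eval_choice[OF test])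
  qed
  then show ?thesis
    unfolding computable_fun_def by blast
qed

lemmas computable_fun_intros = computable_fun_id computable_fun_bfst computable_fun_bsnd
  computable_fun_bpair computable_fun_btail computable_fun_bcons_0 computable_fun_bcons_1
  computable_fun_bind


section \<open>Reductions between multi-valued functions in terms of names\<close>

text \<open>Realizers see names only. A multi-valued function acts on realizers through two relations on
  Baire space: which points name instances, and which points name correct answers to
  them. Reducibility depends on the represented spaces only through these relations.\<close>

definition valid_input :: "'x mvf \<Rightarrow> baire \<Rightarrow> bool" where
  "valid_input f p \<longleftrightarrow> (\<exists>x. rep (source f) p = Some x \<and> x \<in> mdom f)"

definition valid_output :: "'x mvf \<Rightarrow> baire \<Rightarrow> baire \<Rightarrow> bool" where
  "valid_output f p q \<longleftrightarrow>
    (\<exists>x y. rep (source f) p = Some x \<and> rep (target f) q = Some y \<and> y \<in> app f x)"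

definition solvable :: "'x mvf \<Rightarrow> bool" where
  "solvable f \<longleftrightarrow> (\<forall>p. valid_input f p \<longrightarrow> (\<exists>q. valid_output f p q))"

lemma realizer_iff:
  "realizer F f \<longleftrightarrow> (\<forall>p. valid_input f p \<longrightarrow> (\<exists>q. F p = Some q \<and> valid_output f p q))"
  unfolding realizer_def valid_input_def valid_output_def by fastforce

lemma has_computable_point_iff:
  "has_computable_point f \<longleftrightarrow> (\<exists>p. computable_point p \<and> valid_input f p)"
  unfolding has_computable_point_def computable_element_def valid_input_def by blast

lemma ex_realizer:
  assumes "solvable f"
  shows "\<exists>F. realizer F f"
proof -
  obtain F where "\<And>p. valid_input f p \<Longrightarrow> valid_output f p (F p)"
    using assms unfolding solvable_def by metis
  then have "realizer (\<lambda>p. Some (F p)) f"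
    by (simp add: realizer_iff)
  then show ?thesis
    by blast
qed

text \<open>A reduction has to cope with every realizer of \<open>g\<close>. Altering one realizer at a single name
  shows that a reduction may rely on nothing but the following: the query sent to \<open>g\<close> is a name
  of a point in the domain, and every name of a correct answer is turned into a correct answer.
  Existence of a realizer of \<open>g\<close> is essential: otherwise any problem would reduce to \<open>g\<close>.\<close>

lemma weihrauch_le_Mvf_iff:
  assumes "solvable g"
  shows "Mvf f \<le>\<^sub>W Mvf g \<longleftrightarrow> (\<exists>H K. computable_fun H \<and> computable_fun K \<and>
    (\<forall>p. valid_input f p \<longrightarrow> (\<exists>s. K p = Some s \<and> valid_input g s \<and>
      (\<forall>r. valid_output g s r \<longrightarrow> (\<exists>q. H (bpair p r) = Some q \<and> valid_output f p q)))))"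
    (is "_ \<longleftrightarrow> (\<exists>H K. _ \<and> _ \<and> ?pointwise H K)")
proof -
  let ?via = "\<lambda>H K G p. Option.bind (K p) (\<lambda>s. Option.bind (G s) (\<lambda>r. H (bpair p r)))"
  have "(\<forall>G. realizer G g \<longrightarrow> realizer (?via H K G) f) \<longleftrightarrow> ?pointwise H K" for H K
  proof
    assume red: "\<forall>G. realizer G g \<longrightarrow> realizer (?via H K G) f"
    obtain G where G: "realizer G g"
      using ex_realizer[OF assms] by blast
    show "?pointwise H K"
    proof (intro allI impI)
      fix p assume p: "valid_input f p"
      have via: "\<exists>q. ?via H K G' p = Some q \<and> valid_output f p q" if "realizer G' g" for G'
        using red that p by (simp add: realizer_iff)
      obtain s where s: "K p = Some s"
        using via[OF G] by (cases "K p") auto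
      have "valid_input g s"
      proof (rule ccontr)
        assume "\<not> valid_input g s"
        with G have "realizer (G(s := None)) g"
          by (auto simp: realizer_iff)
        from via[OF this] show False
          by (simp add: s)
      qed
      moreover have "\<exists>q. H (bpair p r) = Some q \<and> valid_output f p q"
        if "valid_output g s r" for r
      proof -
        have "realizer (G(s \<mapsto> r)) g"
          using G that by (auto simp: realizer_iff)
        from via[OF this] show ?thesis
          by (simp add: s)
      qed
      ultimately show "\<exists>s. K p = Some s \<and> valid_input g s \<and>
          (\<forall>r. valid_output g s r \<longrightarrow> (\<exists>q. H (bpair p r) = Some q \<and> valid_output f p q))"
        using s by blast
    qed
  next
    assume pw: "?pointwise H K"
    show "\<forall>G. realizer G g \<longrightarrow> realizer (?via H K G) f"
    proof (intro allI impI)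
      fix G assume G: "realizer G g"
      have "\<exists>q. ?via H K G p = Some q \<and> valid_output f p q" if "valid_input f p" for p
      proof -
        obtain s where s: "K p = Some s" "valid_input g s"
          and H: "\<And>r. valid_output g s r \<Longrightarrow> \<exists>q. H (bpair p r) = Some q \<and> valid_output f p q"
          using pw \<open>valid_input f p\<close> by blast
        obtain r where r: "G s = Some r" "valid_output g s r"
          using G s(2) by (auto simp: realizer_iff)
        show ?thesis
          using H[OF r(2)] by (simp add: s(1) r(1))
      qed
      then show "realizer (?via H K G) f"
        by (simp add: realizer_iff)
    qed
  qed
  then show ?thesis
    by (simp add: weihrauch_le_def)
qed

lemma weihrauch_le_MvfI:
  assumes "solvable g" and "computable_fun H" and "computable_fun (\<lambda>p. Some (K p))"
    and "\<And>p. valid_input f p \<Longrightarrow> valid_input g (K p)"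
    and "\<And>p r. valid_input f p \<Longrightarrow> valid_output g (K p) r
      \<Longrightarrow> \<exists>q. H (bpair p r) = Some q \<and> valid_output f p q"
  shows "Mvf f \<le>\<^sub>W Mvf g"
  unfolding weihrauch_le_Mvf_iff[OF assms(1)]
  using assms(2-) by (intro exI[of _ H] exI[of _ "\<lambda>p. Some (K p)"]) auto

lemma weihrauch_le_MvfE:
  assumes "Mvf f \<le>\<^sub>W Mvf g" and "solvable g"
  obtains H K where "computable_fun H" and "computable_fun K"
    and "\<And>p. valid_input f p \<Longrightarrow> \<exists>s. K p = Some s \<and> valid_input g s \<and>
      (\<forall>r. valid_output g s r \<longrightarrow> (\<exists>q. H (bpair p r) = Some q \<and> valid_output f p q))"
  using assms(1) unfolding weihrauch_le_Mvf_iff[OF assms(2)] by blast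

lemma weihrauch_le_refl: "f \<le>\<^sub>W f"
proof -
  have "computable_fun (\<lambda>r. Some (bsnd r))"
    by (intro computable_fun_intros)
  then show ?thesis
    unfolding weihrauch_le_def
    by (intro exI[of _ "\<lambda>r. Some (bsnd r)"] exI[of _ Some]) (simp add: computable_fun_id)
qed

text \<open>The queries are composed. On the way back, \<open>H'\<close> needs the query \<open>K p\<close>
  that is sent to \<open>g\<close>. Only \<open>p\<close> and the answer of \<open>h\<close> are at hand, so \<open>K p\<close> is computed again.\<close>

lemma weihrauch_le_trans:
  assumes "f \<le>\<^sub>W g" and "g \<le>\<^sub>W h"
  shows "f \<le>\<^sub>W h"
proof -
  obtain H K where HK: "computable_fun H" "computable_fun K"
    and red: "\<And>G. G \<in> realizer_set g \<Longrightarrow>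
      (\<lambda>p. Option.bind (K p) (\<lambda>s. Option.bind (G s) (\<lambda>r. H (bpair p r)))) \<in> realizer_set f"
    using assms(1) unfolding weihrauch_le_def by blast
  obtain H' K' where HK': "computable_fun H'" "computable_fun K'"
    and red': "\<And>G. G \<in> realizer_set h \<Longrightarrow>
      (\<lambda>p. Option.bind (K' p) (\<lambda>s. Option.bind (G s) (\<lambda>r. H' (bpair p r)))) \<in> realizer_set g"
    using assms(2) unfolding weihrauch_le_def by blast
  note computable = computable_fun_intros computable_fun_apply[OF HK(1)]
    computable_fun_apply[OF HK(2)] computable_fun_apply[OF HK'(1)] computable_fun_apply[OF HK'(2)]
  let ?K = "\<lambda>p. Option.bind (K p) K'"
  let ?H = "\<lambda>t. Option.bind (K (bfst t)) (\<lambda>s. Option.bind (H' (bpair s (bsnd t)))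
    (\<lambda>u. H (bpair (bfst t) u)))"
  have "computable_fun ?K" "computable_fun ?H"
    by (intro computable)+
  moreover have "(\<lambda>p. Option.bind (?K p) (\<lambda>s. Option.bind (G s) (\<lambda>r. ?H (bpair p r))))
      \<in> realizer_set f" if "G \<in> realizer_set h" for G
  proof -
    have "Option.bind (?K p) (\<lambda>s. Option.bind (G s) (\<lambda>r. ?H (bpair p r))) =
        Option.bind (K p) (\<lambda>s. Option.bind
          (Option.bind (K' s) (\<lambda>s'. Option.bind (G s') (\<lambda>r. H' (bpair s r))))
          (\<lambda>r. H (bpair p r)))" for p
      by (cases "K p") simp_all
    then show ?thesis
      using red[OF red'[OF that]] by simp
  qed
  ultimately show ?thesis
    unfolding weihrauch_le_def by blast
qed

lemma weihrauch_le_NoRealizer: "f \<le>\<^sub>W NoRealizer"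
  unfolding weihrauch_le_def using computable_fun_id by auto

lemma NoRealizer_not_le:
  assumes "solvable f"
  shows "\<not> NoRealizer \<le>\<^sub>W Mvf f"
  using ex_realizer[OF assms] by (auto simp: weihrauch_le_def)


section \<open>Products and sums of reductions\<close>

lemma source_mvf_prod: "source (mvf_prod f g) = prod_space (source f) (source g)"
  by (simp add: mvf_prod_def)

lemma mdom_mvf_prod: "Tup x u \<in> mdom (mvf_prod f g) \<longleftrightarrow> x \<in> mdom f \<and> u \<in> mdom g"
  unfolding mdom_def mvf_prod_def by auto

lemma valid_input_mvf_prod:
  "valid_input (mvf_prod f g) p \<longleftrightarrow> valid_input f (bfst p) \<and> valid_input g (bsnd p)"
  unfolding valid_input_def
  by (auto simp: source_mvf_prod prod_space_def mdom_mvf_prod split: option.splits)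

lemma valid_output_mvf_prod:
  "valid_output (mvf_prod f g) p q \<longleftrightarrow>
    valid_output f (bfst p) (bfst q) \<and> valid_output g (bsnd p) (bsnd q)"
  unfolding valid_output_def mvf_prod_def prod_space_def by (auto split: option.splits)

lemma source_mvf_sum: "source (mvf_sum f g) = prod_space (source f) (source g)"
  by (simp add: mvf_sum_def)

lemma mdom_mvf_sum: "Tup x u \<in> mdom (mvf_sum f g) \<longleftrightarrow> x \<in> mdom f \<and> u \<in> mdom g"
  by (auto simp: mdom_def mvf_sum_def)

lemma valid_input_mvf_sum:
  "valid_input (mvf_sum f g) p \<longleftrightarrow> valid_input f (bfst p) \<and> valid_input g (bsnd p)"
  unfolding valid_input_def
  by (auto simp: source_mvf_sum prod_space_def mdom_mvf_sum split: option.splits)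

lemma valid_output_mvf_sum:
  "valid_output (mvf_sum f g) p q \<longleftrightarrow> valid_input f (bfst p) \<and> valid_input g (bsnd p) \<and>
    (if q 0 = 0 then valid_output f (bfst p) (btail q) else valid_output g (bsnd p) (btail q))"
  unfolding valid_output_def valid_input_def btail_def mvf_sum_def prod_space_def sum_space_def
  by (auto split: option.splits if_splits)

lemma solvable_mvf_prod: "solvable f \<Longrightarrow> solvable g \<Longrightarrow> solvable (mvf_prod f g)"
  unfolding solvable_def valid_input_mvf_prod valid_output_mvf_prod
  by (metis bfst_bpair bsnd_bpair)

lemma solvable_mvf_sum: "solvable f \<Longrightarrow> solvable g \<Longrightarrow> solvable (mvf_sum f g)"
  unfolding solvable_def valid_input_mvf_sum valid_output_mvf_sum
  by (metis bcons_0 btail_bcons)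

text \<open>Whoever can answer one of the two queries can answer the sum, by adding the tag of that
  query.\<close>

lemma mvf_sum_le_left:
  assumes "solvable f"
  shows "Mvf (mvf_sum f g) \<le>\<^sub>W Mvf f"
proof (rule weihrauch_le_MvfI)
  show "computable_fun (\<lambda>r. Some (bcons 0 (bsnd r)))" "computable_fun (\<lambda>p. Some (bfst p))"
    by (intro computable_fun_intros)+
qed (auto simp: assms valid_input_mvf_sum valid_output_mvf_sum)

lemma mvf_sum_le_right:
  assumes "solvable g"
  shows "Mvf (mvf_sum f g) \<le>\<^sub>W Mvf g"
proof (rule weihrauch_le_MvfI)
  show "computable_fun (\<lambda>r. Some (bcons 1 (bsnd r)))" "computable_fun (\<lambda>p. Some (bsnd p))"
    by (intro computable_fun_intros)+
qed (auto simp: assms valid_input_mvf_sum valid_output_mvf_sum)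

text \<open>The query to the sum consists of the queries of both reductions. The tag of the answer tells
  which of the two queries has been answered, and the corresponding reduction finishes.\<close>

lemma mvf_sum_greatest:
  assumes "solvable f" "solvable g" and "Mvf h \<le>\<^sub>W Mvf f" "Mvf h \<le>\<^sub>W Mvf g"
  shows "Mvf h \<le>\<^sub>W Mvf (mvf_sum f g)"
proof -
  obtain H K where HK: "computable_fun H" "computable_fun K"
    and red: "\<And>p. valid_input h p \<Longrightarrow> \<exists>s. K p = Some s \<and> valid_input f s \<and>
      (\<forall>r. valid_output f s r \<longrightarrow> (\<exists>q. H (bpair p r) = Some q \<and> valid_output h p q))"
    using weihrauch_le_MvfE[OF assms(3,1)] by blast
  obtain H' K' where HK': "computable_fun H'" "computable_fun K'"
    and red': "\<And>p. valid_input h p \<Longrightarrow> \<exists>s. K' p = Some s \<and> valid_input g s \<and>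
      (\<forall>r. valid_output g s r \<longrightarrow> (\<exists>q. H' (bpair p r) = Some q \<and> valid_output h p q))"
    using weihrauch_le_MvfE[OF assms(4,2)] by blast
  note computable = computable_fun_intros computable_fun_apply[OF HK(1)]
    computable_fun_apply[OF HK(2)] computable_fun_apply[OF HK'(1)] computable_fun_apply[OF HK'(2)]
  let ?K = "\<lambda>p. Option.bind (K p) (\<lambda>s. Option.bind (K' p) (\<lambda>s'. Some (bpair s s')))"
  let ?H = "\<lambda>t. if bsnd t 0 = 0 then H (bpair (bfst t) (btail (bsnd t)))
    else H' (bpair (bfst t) (btail (bsnd t)))"
  have K: "computable_fun ?K"
    by (intro computable)
  have H: "computable_fun ?H"
    by (intro computable_fun_if[of bsnd] computable)
  have "\<exists>s. ?K p = Some s \<and> valid_input (mvf_sum f g) s \<and> (\<forall>r. valid_output (mvf_sum f g) s r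
      \<longrightarrow> (\<exists>q. ?H (bpair p r) = Some q \<and> valid_output h p q))" if "valid_input h p" for p
    using red[OF that] red'[OF that] by (auto simp: valid_input_mvf_sum valid_output_mvf_sum)
  with K H show ?thesis
    unfolding weihrauch_le_Mvf_iff[OF solvable_mvf_sum[OF assms(1,2)]] by blast
qed

lemma mvf_prod_mono:
  assumes "solvable f'" "solvable g'" and "Mvf f \<le>\<^sub>W Mvf f'" "Mvf g \<le>\<^sub>W Mvf g'"
  shows "Mvf (mvf_prod f g) \<le>\<^sub>W Mvf (mvf_prod f' g')"
proof -
  obtain H K where HK: "computable_fun H" "computable_fun K"
    and red: "\<And>p. valid_input f p \<Longrightarrow> \<exists>s. K p = Some s \<and> valid_input f' s \<and>
      (\<forall>r. valid_output f' s r \<longrightarrow> (\<exists>q. H (bpair p r) = Some q \<and> valid_output f p q))"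
    using weihrauch_le_MvfE[OF assms(3,1)] by blast
  obtain H' K' where HK': "computable_fun H'" "computable_fun K'"
    and red': "\<And>p. valid_input g p \<Longrightarrow> \<exists>s. K' p = Some s \<and> valid_input g' s \<and>
      (\<forall>r. valid_output g' s r \<longrightarrow> (\<exists>q. H' (bpair p r) = Some q \<and> valid_output g p q))"
    using weihrauch_le_MvfE[OF assms(4,2)] by blast
  note computable = computable_fun_intros computable_fun_apply[OF HK(1)]
    computable_fun_apply[OF HK(2)] computable_fun_apply[OF HK'(1)] computable_fun_apply[OF HK'(2)]
  let ?K = "\<lambda>p. Option.bind (K (bfst p))
    (\<lambda>s. Option.bind (K' (bsnd p)) (\<lambda>s'. Some (bpair s s')))"
  let ?H = "\<lambda>t. Option.bind (H (bpair (bfst (bfst t)) (bfst (bsnd t))))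
    (\<lambda>q. Option.bind (H' (bpair (bsnd (bfst t)) (bsnd (bsnd t)))) (\<lambda>q'. Some (bpair q q')))"
  have "computable_fun ?K" "computable_fun ?H"
    by (intro computable)+
  moreover have "\<exists>s. ?K p = Some s \<and> valid_input (mvf_prod f' g') s \<and>
      (\<forall>r. valid_output (mvf_prod f' g') s r
        \<longrightarrow> (\<exists>q. ?H (bpair p r) = Some q \<and> valid_output (mvf_prod f g) p q))"
    if p: "valid_input (mvf_prod f g) p" for p
  proof -
    obtain s where s: "K (bfst p) = Some s" "valid_input f' s"
      "\<And>r. valid_output f' s r \<Longrightarrow>
        \<exists>q. H (bpair (bfst p) r) = Some q \<and> valid_output f (bfst p) q"
      using red[of "bfst p"] p unfolding valid_input_mvf_prod by blast
    obtain s' where s': "K' (bsnd p) = Some s'" "valid_input g' s'"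
      "\<And>r. valid_output g' s' r \<Longrightarrow>
        \<exists>q. H' (bpair (bsnd p) r) = Some q \<and> valid_output g (bsnd p) q"
      using red'[of "bsnd p"] p unfolding valid_input_mvf_prod by blast
    have "\<exists>q. ?H (bpair p r) = Some q \<and> valid_output (mvf_prod f g) p q"
      if "valid_output (mvf_prod f' g') (bpair s s') r" for r
      using s(3)[of "bfst r"] s'(3)[of "bsnd r"] that by (auto simp: valid_output_mvf_prod)
    then show ?thesis
      using s(1,2) s'(1,2) by (simp add: valid_input_mvf_prod)
  qed
  ultimately show ?thesis
    unfolding weihrauch_le_Mvf_iff[OF solvable_mvf_prod[OF assms(1,2)]] by blast
qed

lemma mvf_prod_assoc:
  assumes "solvable f" "solvable g" "solvable h"
  shows "Mvf (mvf_prod (mvf_prod f g) h) \<equiv>\<^sub>W Mvf (mvf_prod f (mvf_prod g h))"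
proof -
  let ?right = "\<lambda>p. bpair (bfst (bfst p)) (bpair (bsnd (bfst p)) (bsnd p))"
  let ?left = "\<lambda>p. bpair (bpair (bfst p) (bfst (bsnd p))) (bsnd (bsnd p))"
  have "Mvf (mvf_prod (mvf_prod f g) h) \<le>\<^sub>W Mvf (mvf_prod f (mvf_prod g h))"
  proof (rule weihrauch_le_MvfI)
    show "computable_fun (\<lambda>r. Some (?left (bsnd r)))" "computable_fun (\<lambda>p. Some (?right p))"
      by (intro computable_fun_intros)+
  qed (auto simp: assms solvable_mvf_prod valid_input_mvf_prod valid_output_mvf_prod)
  moreover have "Mvf (mvf_prod f (mvf_prod g h)) \<le>\<^sub>W Mvf (mvf_prod (mvf_prod f g) h)"
  proof (rule weihrauch_le_MvfI)
    show "computable_fun (\<lambda>r. Some (?right (bsnd r)))" "computable_fun (\<lambda>p. Some (?left p))"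
      by (intro computable_fun_intros)+
  qed (auto simp: assms solvable_mvf_prod valid_input_mvf_prod valid_output_mvf_prod)
  ultimately show ?thesis
    by (simp add: weihrauch_equiv_def)
qed


section \<open>The identity of Baire space\<close>

definition baire_identity :: "'a obj mvf" where
  "baire_identity = \<lparr>source = baire_space, target = baire_space,
    app = (\<lambda>x. if x \<in> points baire_space then {x} else {})\<rparr>"

lemma valid_input_baire_identity: "valid_input baire_identity p"
  and valid_output_baire_identity: "valid_output baire_identity p q \<longleftrightarrow> q = p"
  by (auto simp: valid_input_def valid_output_def baire_identity_def baire_space_def mdom_def)

lemma solvable_baire_identity: "solvable baire_identity"
  by (simp add: solvable_def valid_output_baire_identity)

lemma has_computable_point_baire_identity: "has_computable_point baire_identity"
  using computable_point_zero valid_input_baire_identity by (auto simp: has_computable_point_iff)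

text \<open>The query that a reduction sends on a computable input is itself computable, and it names a
  point of the domain. Conversely, a computable name of such a point can serve as a constant
  query, whose answer is discarded.\<close>

lemma baire_identity_le_iff:
  assumes "solvable f"
  shows "Mvf baire_identity \<le>\<^sub>W Mvf f \<longleftrightarrow> has_computable_point f"
proof
  assume "Mvf baire_identity \<le>\<^sub>W Mvf f"
  then obtain K where "computable_fun K" "\<And>p. \<exists>s. K p = Some s \<and> valid_input f s"
    using weihrauch_le_MvfE[OF _ assms] valid_input_baire_identity by metis
  then show "has_computable_point f"
    unfolding has_computable_point_iff
    using computable_point_image computable_point_zero by blast
next
  assume "has_computable_point f"
  then obtain s where s: "computable_point s" "valid_input f s"
    by (auto simp: has_computable_point_iff)
  show "Mvf baire_identity \<le>\<^sub>W Mvf f"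
  proof (rule weihrauch_le_MvfI[OF assms])
    show "computable_fun (\<lambda>r. Some (bfst r))"
      by (intro computable_fun_intros)
    show "computable_fun (\<lambda>_. Some s)"
      by (rule computable_fun_const[OF s(1)])
  qed (auto simp: s(2) valid_output_baire_identity)
qed

text \<open>The only realizer of the identity returns every query unchanged and so contributes no
  information that is not computable.\<close>

lemma le_baire_identity_iff: "Mvf f \<le>\<^sub>W Mvf baire_identity \<longleftrightarrow> computable_mvf f"
proof
  assume "Mvf f \<le>\<^sub>W Mvf baire_identity"
  then obtain H K where HK: "computable_fun H" "computable_fun K"
    and red: "\<And>p. valid_input f p \<Longrightarrow> \<exists>s. K p = Some s \<and>
      (\<exists>q. H (bpair p s) = Some q \<and> valid_output f p q)"
    using weihrauch_le_MvfE[OF _ solvable_baire_identity]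
    by (metis valid_output_baire_identity)
  note computable = computable_fun_intros computable_fun_apply[OF HK(1)]
    computable_fun_apply[OF HK(2)]
  let ?F = "\<lambda>p. Option.bind (K p) (\<lambda>s. H (bpair p s))"
  have "computable_fun ?F"
    by (intro computable)
  moreover have "realizer ?F f"
    using red by (fastforce simp: realizer_iff)
  ultimately show "computable_mvf f"
    unfolding computable_mvf_def by blast
next
  assume "computable_mvf f"
  then obtain F where F: "computable_fun F" "realizer F f"
    unfolding computable_mvf_def by blast
  show "Mvf f \<le>\<^sub>W Mvf baire_identity"
  proof (rule weihrauch_le_MvfI[OF solvable_baire_identity])
    show "computable_fun (\<lambda>r. F (bsnd r))"
      by (intro computable_fun_apply[OF F(1)] computable_fun_intros)
    show "computable_fun (\<lambda>p. Some p)"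
      by (rule computable_fun_id)
  qed (use F(2) in \<open>auto simp: valid_input_baire_identity valid_output_baire_identity
    realizer_iff\<close>)
qed

text \<open>For the reduction of \<open>f\<close> to the product, some valid input for the identity has to be supplied;
  that of \<open>f\<close> itself will do, because every point of Baire space is valid.\<close>

lemma mvf_prod_baire_identity_left:
  assumes "solvable f"
  shows "Mvf (mvf_prod baire_identity f) \<equiv>\<^sub>W Mvf f"
proof -
  have "Mvf (mvf_prod baire_identity f) \<le>\<^sub>W Mvf f"
  proof (rule weihrauch_le_MvfI[OF assms])
    show "computable_fun (\<lambda>r. Some (bpair (bfst (bfst r)) (bsnd r)))"
      "computable_fun (\<lambda>p. Some (bsnd p))"
      by (intro computable_fun_intros)+
  qed (auto simp: valid_input_mvf_prod valid_output_mvf_prod valid_output_baire_identity)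
  moreover have "Mvf f \<le>\<^sub>W Mvf (mvf_prod baire_identity f)"
  proof (rule weihrauch_le_MvfI[OF solvable_mvf_prod[OF solvable_baire_identity assms]])
    show "computable_fun (\<lambda>r. Some (bsnd (bsnd r)))" "computable_fun (\<lambda>p. Some (bpair p p))"
      by (intro computable_fun_intros)+
  qed (auto simp: valid_input_mvf_prod valid_output_mvf_prod valid_input_baire_identity)
  ultimately show ?thesis
    by (simp add: weihrauch_equiv_def)
qed

lemma mvf_prod_baire_identity_right:
  assumes "solvable f"
  shows "Mvf (mvf_prod f baire_identity) \<equiv>\<^sub>W Mvf f"
proof -
  have "Mvf (mvf_prod f baire_identity) \<le>\<^sub>W Mvf f"
  proof (rule weihrauch_le_MvfI[OF assms])
    show "computable_fun (\<lambda>r. Some (bpair (bsnd r) (bsnd (bfst r))))"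
      "computable_fun (\<lambda>p. Some (bfst p))"
      by (intro computable_fun_intros)+
  qed (auto simp: valid_input_mvf_prod valid_output_mvf_prod valid_output_baire_identity)
  moreover have "Mvf f \<le>\<^sub>W Mvf (mvf_prod f baire_identity)"
  proof (rule weihrauch_le_MvfI[OF solvable_mvf_prod[OF assms solvable_baire_identity]])
    show "computable_fun (\<lambda>r. Some (bfst (bsnd r)))" "computable_fun (\<lambda>p. Some (bpair p p))"
      by (intro computable_fun_intros)+
  qed (auto simp: valid_input_mvf_prod valid_output_mvf_prod valid_input_baire_identity)
  ultimately show ?thesis
    by (simp add: weihrauch_equiv_def)
qed


section \<open>The semi-lattice and the monoids of degrees\<close>

lemma NoRealizer_le_iff:
  assumes "\<And>f. p = Mvf f \<Longrightarrow> solvable f"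
  shows "NoRealizer \<le>\<^sub>W p \<longleftrightarrow> p = NoRealizer"
  using assms NoRealizer_not_le weihrauch_le_refl by (cases p) auto

lemma weihrauch_equiv_refl: "f \<equiv>\<^sub>W f"
  by (simp add: weihrauch_equiv_def weihrauch_le_refl)

lemma weihrauch_equiv_sym: "f \<equiv>\<^sub>W g \<Longrightarrow> g \<equiv>\<^sub>W f"
  by (simp add: weihrauch_equiv_def)

lemma weihrauch_equiv_trans: "f \<equiv>\<^sub>W g \<Longrightarrow> g \<equiv>\<^sub>W h \<Longrightarrow> f \<equiv>\<^sub>W h"
  unfolding weihrauch_equiv_def by (blast intro: weihrauch_le_trans)

lemma degree_cong: "f \<equiv>\<^sub>W g \<Longrightarrow> degree R f = degree R g"
  unfolding degree_def using weihrauch_equiv_sym weihrauch_equiv_trans by blast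

text \<open>The representatives of the elements of \<^term>\<open>degrees R\<close>.\<close>

definition pointed_problems :: "'x repspace set \<Rightarrow> 'x problem set" where
  "pointed_problems R = insert NoRealizer (Mvf ` {f \<in> mvfs R. has_computable_point f})"

lemma degrees_eq: "degrees R = degree R ` pointed_problems R"
  unfolding degrees_def pointed_problems_def zero_degree_def by blast

lemma pointed_problems_subset: "pointed_problems R \<subseteq> problems R"
  unfolding pointed_problems_def problems_def by blast

locale weihrauch_universe =
  fixes R :: "'a obj repspace set"
  assumes represented: "X \<in> R \<Longrightarrow> represented_space X"
    and baire_space_mem: "baire_space \<in> R"
    and prod_space_mem: "X \<in> R \<Longrightarrow> Y \<in> R \<Longrightarrow> prod_space X Y \<in> R"
    and sum_space_mem: "X \<in> R \<Longrightarrow> Y \<in> R \<Longrightarrow> sum_space X Y \<in> R"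
begin

text \<open>Surjectivity of the representation of the target enters here, and only here: a correct answer
  has a name.\<close>

lemma solvable_mvfs:
  assumes "f \<in> mvfs R"
  shows "solvable f"
  unfolding solvable_def
proof (intro allI impI)
  fix p assume "valid_input f p"
  then obtain x y where x: "rep (source f) p = Some x" and y: "y \<in> app f x"
    unfolding valid_input_def mdom_def by blast
  have "y \<in> points (target f)"
    using assms y unfolding mvfs_def by fastforce
  also have "points (target f) = ran (rep (target f))"
    using assms represented unfolding mvfs_def represented_space_def by simp
  finally obtain q where "rep (target f) q = Some y"
    by (auto simp: ran_def)
  then show "\<exists>q. valid_output f p q"
    using x y unfolding valid_output_def by blast
qed

lemma baire_identity_mvfs: "baire_identity \<in> mvfs R"
  using baire_space_mem by (simp add: mvfs_def baire_identity_def)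

lemma mvf_prod_mvfs:
  assumes "f \<in> mvfs R" "g \<in> mvfs R"
  shows "mvf_prod f g \<in> mvfs R"
proof -
  have f: "y \<in> app f x \<Longrightarrow> x \<in> points (source f) \<and> y \<in> points (target f)" for x y
    using assms(1) by (auto simp: mvfs_def)
  have g: "y \<in> app g x \<Longrightarrow> x \<in> points (source g) \<and> y \<in> points (target g)" for x y
    using assms(2) by (auto simp: mvfs_def)
  have "app (mvf_prod f g) z \<subseteq> points (target (mvf_prod f g))" for z
    using f g by (fastforce simp: mvf_prod_def prod_space_def)
  moreover have "z \<in> points (source (mvf_prod f g))" if "app (mvf_prod f g) z \<noteq> {}" for z
    using f g that by (fastforce simp: mvf_prod_def prod_space_def)
  moreover have "source (mvf_prod f g) \<in> R" "target (mvf_prod f g) \<in> R"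
    using assms prod_space_mem by (auto simp: mvf_prod_def mvfs_def)
  ultimately show ?thesis
    unfolding mvfs_def by blast
qed

lemma mvf_sum_mvfs:
  assumes "f \<in> mvfs R" "g \<in> mvfs R"
  shows "mvf_sum f g \<in> mvfs R"
proof -
  have f: "y \<in> app f x \<Longrightarrow> x \<in> points (source f) \<and> y \<in> points (target f)" for x y
    using assms(1) by (auto simp: mvfs_def)
  have g: "y \<in> app g x \<Longrightarrow> x \<in> points (source g) \<and> y \<in> points (target g)" for x y
    using assms(2) by (auto simp: mvfs_def)
  have "app (mvf_sum f g) z \<subseteq> points (target (mvf_sum f g))" for z
    using f g by (auto simp: mvf_sum_def sum_space_def split: obj.splits if_splits)
  moreover have "z \<in> points (source (mvf_sum f g))" if "app (mvf_sum f g) z \<noteq> {}" for z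
    using f g that
    by (auto simp: mvf_sum_def prod_space_def mdom_def split: obj.splits if_splits)
  moreover have "source (mvf_sum f g) \<in> R" "target (mvf_sum f g) \<in> R"
    using assms prod_space_mem sum_space_mem by (auto simp: mvf_sum_def mvfs_def)
  ultimately show ?thesis
    unfolding mvfs_def by blast
qed

lemma pointed_problemsE:
  assumes "p \<in> pointed_problems R"
  obtains "p = NoRealizer"
  | f where "p = Mvf f" "f \<in> mvfs R" "has_computable_point f" "solvable f"
  using assms solvable_mvfs unfolding pointed_problems_def by blast

lemma pointed_problems_Mvf:
  "Mvf f \<in> pointed_problems R \<longleftrightarrow> f \<in> mvfs R \<and> has_computable_point f"
  unfolding pointed_problems_def by auto

lemma pointed_problems_NoRealizer: "NoRealizer \<in> pointed_problems R"
  unfolding pointed_problems_def by simp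

text \<open>A computable point in the domain is inherited upwards, because its existence means that the
  identity of Baire space is reducible. Hence a degree in \<^term>\<open>degrees R\<close> contains no function
  without such a point, although \<^const>\<open>degree\<close> ranges over all problems.\<close>

lemma pointed_problems_upward:
  assumes "p \<in> pointed_problems R" and "q \<in> problems R" and "p \<le>\<^sub>W q"
  shows "q \<in> pointed_problems R"
  using assms(1)
proof (cases rule: pointed_problemsE)
  case 1
  with assms(2,3) show ?thesis
    using NoRealizer_le_iff[of q] solvable_mvfs pointed_problems_NoRealizer
    by (auto simp: problems_def)
next
  case (2 f)
  show ?thesis
  proof (cases q)
    case NoRealizer
    then show ?thesis
      by (simp add: pointed_problems_NoRealizer)
  next
    case (Mvf g)
    with assms(2) have g: "g \<in> mvfs R"
      by (auto simp: problems_def)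
    have "Mvf baire_identity \<le>\<^sub>W Mvf g"
      using 2 assms(3) Mvf baire_identity_le_iff weihrauch_le_trans by blast
    then show ?thesis
      using g Mvf baire_identity_le_iff solvable_mvfs pointed_problems_Mvf by blast
  qed
qed

lemma degree_subset_pointed:
  assumes "p \<in> pointed_problems R"
  shows "degree R p = {q \<in> pointed_problems R. q \<equiv>\<^sub>W p}"
  using pointed_problems_upward[OF assms] pointed_problems_subset
  unfolding degree_def weihrauch_equiv_def by blast

lemma degree_self: "p \<in> pointed_problems R \<Longrightarrow> p \<in> degree R p"
  by (simp add: degree_subset_pointed weihrauch_equiv_refl)

lemma degree_le_iff:
  assumes "p \<in> pointed_problems R" "q \<in> pointed_problems R"
  shows "degree_le (degree R p) (degree R q) \<longleftrightarrow> p \<le>\<^sub>W q"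
proof
  assume "degree_le (degree R p) (degree R q)"
  then obtain p' q' where "p \<le>\<^sub>W p'" "p' \<le>\<^sub>W q'" "q' \<le>\<^sub>W q"
    by (auto simp: degree_le_def degree_def weihrauch_equiv_def)
  then show "p \<le>\<^sub>W q"
    by (blast intro: weihrauch_le_trans)
next
  assume "p \<le>\<^sub>W q"
  then show "degree_le (degree R p) (degree R q)"
    using assms degree_self unfolding degree_le_def by blast
qed

lemma baire_identity_pointed: "Mvf baire_identity \<in> pointed_problems R"
  by (simp add: pointed_problems_Mvf baire_identity_mvfs has_computable_point_baire_identity)

text \<open>Being above the identity amounts to a computable point in the domain, being below it to
  computability.\<close>

lemma one_degree_eq: "one_degree R = degree R (Mvf baire_identity)"
proof -
  have "\<not> NoRealizer \<equiv>\<^sub>W Mvf baire_identity"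
    by (simp add: weihrauch_equiv_def NoRealizer_not_le solvable_baire_identity)
  then show ?thesis
    unfolding one_degree_def degree_subset_pointed[OF baire_identity_pointed]
    using solvable_mvfs
    by (auto simp: pointed_problems_def weihrauch_equiv_def
        baire_identity_le_iff le_baire_identity_iff)
qed

lemma baire_identity_least: "p \<in> pointed_problems R \<Longrightarrow> Mvf baire_identity \<le>\<^sub>W p"
  by (elim pointed_problemsE) (simp_all add: weihrauch_le_NoRealizer baire_identity_le_iff)

lemma problem_sum_pointed:
  assumes "p \<in> pointed_problems R" "q \<in> pointed_problems R"
  shows "problem_sum p q \<in> pointed_problems R"
proof -
  have "has_computable_point (mvf_sum f g)"
    if "has_computable_point f" "has_computable_point g" for f g :: "'a obj mvf"
    using that computable_point_bpair
    unfolding has_computable_point_iff valid_input_mvf_sum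
    by (metis bfst_bpair bsnd_bpair)
  then show ?thesis
    using assms
    by (elim pointed_problemsE)
      (auto simp: pointed_problems_Mvf pointed_problems_NoRealizer mvf_sum_mvfs)
qed

lemma problem_prod_pointed:
  assumes "p \<in> pointed_problems R" "q \<in> pointed_problems R"
  shows "problem_prod p q \<in> pointed_problems R"
proof -
  have "has_computable_point (mvf_prod f g)"
    if "has_computable_point f" "has_computable_point g" for f g :: "'a obj mvf"
    using that computable_point_bpair
    unfolding has_computable_point_iff valid_input_mvf_prod
    by (metis bfst_bpair bsnd_bpair)
  then show ?thesis
    using assms
    by (elim pointed_problemsE)
      (auto simp: pointed_problems_Mvf pointed_problems_NoRealizer mvf_prod_mvfs)
qed

lemma problem_sum_lower:
  assumes "p \<in> pointed_problems R" "q \<in> pointed_problems R"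
  shows "problem_sum p q \<le>\<^sub>W p" and "problem_sum p q \<le>\<^sub>W q"
  using assms
  by (elim pointed_problemsE; auto simp: weihrauch_le_NoRealizer weihrauch_le_refl
      mvf_sum_le_left mvf_sum_le_right)+

text \<open>If one summand is \<^const>\<open>NoRealizer\<close>, the sum is the other one. If both are multi-valued
  functions, a lower bound is one as well, since \<^const>\<open>NoRealizer\<close> lies below none of them.\<close>

lemma problem_sum_greatest:
  assumes "p \<in> pointed_problems R" "q \<in> pointed_problems R" "r \<in> pointed_problems R"
    and "r \<le>\<^sub>W p" "r \<le>\<^sub>W q"
  shows "r \<le>\<^sub>W problem_sum p q"
  using assms
  by (elim pointed_problemsE; auto simp: mvf_sum_greatest NoRealizer_not_le
      weihrauch_le_NoRealizer)

text \<open>Monotonicity and associativity hold for any greatest lower bound.\<close>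

lemma problem_sum_mono:
  assumes "p \<in> pointed_problems R" "p' \<in> pointed_problems R"
    and "q \<in> pointed_problems R" "q' \<in> pointed_problems R"
    and "p \<le>\<^sub>W p'" "q \<le>\<^sub>W q'"
  shows "problem_sum p q \<le>\<^sub>W problem_sum p' q'"
proof (rule problem_sum_greatest)
  show "problem_sum p q \<le>\<^sub>W p'"
    by (rule weihrauch_le_trans[OF problem_sum_lower(1)[OF assms(1,3)] assms(5)])
  show "problem_sum p q \<le>\<^sub>W q'"
    by (rule weihrauch_le_trans[OF problem_sum_lower(2)[OF assms(1,3)] assms(6)])
qed (simp_all add: assms problem_sum_pointed)

lemma problem_sum_assoc:
  assumes "p \<in> pointed_problems R" "q \<in> pointed_problems R" "r \<in> pointed_problems R"
  shows "problem_sum (problem_sum p q) r \<equiv>\<^sub>W problem_sum p (problem_sum q r)"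
proof -
  have pq: "problem_sum p q \<in> pointed_problems R" and qr: "problem_sum q r \<in> pointed_problems R"
    using assms by (simp_all add: problem_sum_pointed)
  let ?l = "problem_sum (problem_sum p q) r" and ?r = "problem_sum p (problem_sum q r)"
  have l: "?l \<in> pointed_problems R" and r: "?r \<in> pointed_problems R"
    using assms pq qr by (simp_all add: problem_sum_pointed)
  have "?l \<le>\<^sub>W p" "?l \<le>\<^sub>W q" "?l \<le>\<^sub>W r"
    using problem_sum_lower[OF pq assms(3)] problem_sum_lower[OF assms(1,2)]
      weihrauch_le_trans by blast+
  then have "?l \<le>\<^sub>W ?r"
    using assms qr l by (simp add: problem_sum_greatest)
  moreover have "?r \<le>\<^sub>W p" "?r \<le>\<^sub>W q" "?r \<le>\<^sub>W r"
    using problem_sum_lower[OF assms(1) qr] problem_sum_lower[OF assms(2,3)]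
      weihrauch_le_trans by blast+
  then have "?r \<le>\<^sub>W ?l"
    using assms pq r by (simp add: problem_sum_greatest)
  ultimately show ?thesis
    by (simp add: weihrauch_equiv_def)
qed

text \<open>\<^const>\<open>NoRealizer\<close> absorbs products and is the greatest problem. If it is a factor on the left,
  then by the hypothesis also on the right, where the claim is trivial.\<close>

lemma problem_prod_mono:
  assumes "p \<in> pointed_problems R" "p' \<in> pointed_problems R"
    and "q \<in> pointed_problems R" "q' \<in> pointed_problems R"
    and "p \<le>\<^sub>W p'" "q \<le>\<^sub>W q'"
  shows "problem_prod p q \<le>\<^sub>W problem_prod p' q'"
  using assms
  by (elim pointed_problemsE; auto simp: mvf_prod_mono NoRealizer_not_le
      weihrauch_le_NoRealizer)

lemma problem_prod_assoc:
  assumes "p \<in> pointed_problems R" "q \<in> pointed_problems R" "r \<in> pointed_problems R"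
  shows "problem_prod (problem_prod p q) r \<equiv>\<^sub>W problem_prod p (problem_prod q r)"
  using assms
  by (elim pointed_problemsE; auto simp: mvf_prod_assoc weihrauch_equiv_refl)

text \<open>On degrees, an operation is the union of the degrees of all results. For a monotone operation
  all these degrees coincide, so that algebraic laws carry over from problems to degrees.\<close>

lemma degree_operation:
  assumes mono: "\<And>p p' q q'. \<lbrakk>p \<in> pointed_problems R; p' \<in> pointed_problems R;
      q \<in> pointed_problems R; q' \<in> pointed_problems R; p \<le>\<^sub>W p'; q \<le>\<^sub>W q'\<rbrakk> \<Longrightarrow> f p q \<le>\<^sub>W f p' q'"
    and p: "p \<in> pointed_problems R" and q: "q \<in> pointed_problems R"
  shows "(\<Union>p' \<in> degree R p. \<Union>q' \<in> degree R q. degree R (f p' q')) = degree R (f p q)"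
proof -
  have "degree R (f p' q') = degree R (f p q)" if "p' \<in> degree R p" "q' \<in> degree R q" for p' q'
  proof -
    have p': "p' \<in> pointed_problems R" "p' \<le>\<^sub>W p" "p \<le>\<^sub>W p'"
      using that(1) unfolding degree_subset_pointed[OF p] weihrauch_equiv_def by blast+
    have q': "q' \<in> pointed_problems R" "q' \<le>\<^sub>W q" "q \<le>\<^sub>W q'"
      using that(2) unfolding degree_subset_pointed[OF q] weihrauch_equiv_def by blast+
    have "f p' q' \<equiv>\<^sub>W f p q"
      unfolding weihrauch_equiv_def
      using mono[OF p'(1) p q'(1) q p'(2) q'(2)] mono[OF p p'(1) q q'(1) p'(3) q'(3)] ..
    then show ?thesis
      by (rule degree_cong)
  qed
  then show ?thesis
    using degree_self[OF p] degree_self[OF q] by blast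
qed

lemma degree_monoid:
  assumes closed: "\<And>p q. \<lbrakk>p \<in> pointed_problems R; q \<in> pointed_problems R\<rbrakk>
      \<Longrightarrow> f p q \<in> pointed_problems R"
    and mono: "\<And>p p' q q'. \<lbrakk>p \<in> pointed_problems R; p' \<in> pointed_problems R;
      q \<in> pointed_problems R; q' \<in> pointed_problems R; p \<le>\<^sub>W p'; q \<le>\<^sub>W q'\<rbrakk> \<Longrightarrow> f p q \<le>\<^sub>W f p' q'"
    and assoc: "\<And>p q r. \<lbrakk>p \<in> pointed_problems R; q \<in> pointed_problems R;
      r \<in> pointed_problems R\<rbrakk> \<Longrightarrow> f (f p q) r \<equiv>\<^sub>W f p (f q r)"
    and e: "e \<in> pointed_problems R"
    and left: "\<And>p. p \<in> pointed_problems R \<Longrightarrow> f e p \<equiv>\<^sub>W p"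
    and right: "\<And>p. p \<in> pointed_problems R \<Longrightarrow> f p e \<equiv>\<^sub>W p"
  shows "monoid \<lparr>carrier = degrees R,
    mult = (\<lambda>a b. \<Union>p \<in> a. \<Union>q \<in> b. degree R (f p q)), one = degree R e\<rparr>"
proof -
  define m where "m = (\<lambda>a b. \<Union>p \<in> a. \<Union>q \<in> b. degree R (f p q))"
  have m: "m (degree R p) (degree R q) = degree R (f p q)"
    if "p \<in> pointed_problems R" "q \<in> pointed_problems R" for p q
    unfolding m_def by (rule degree_operation[OF mono that])
  have "monoid \<lparr>carrier = degrees R, mult = m, one = degree R e\<rparr>"
  proof (rule monoidI, simp_all only: monoid.simps partial_object.simps)
    fix a b c assume "a \<in> degrees R" "b \<in> degrees R" "c \<in> degrees R"
    then obtain p q r where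
      p: "a = degree R p" "p \<in> pointed_problems R" and
      q: "b = degree R q" "q \<in> pointed_problems R" and
      r: "c = degree R r" "r \<in> pointed_problems R"
      unfolding degrees_eq by blast
    show "m a b \<in> degrees R"
      using closed p q by (simp add: m degrees_eq)
    show "m (m a b) c = m a (m b c)"
      using closed p q r degree_cong[OF assoc] by (simp add: m)
    show "m (degree R e) a = a" "m a (degree R e) = a"
      using e p degree_cong[OF left] degree_cong[OF right] by (simp_all add: m)
  next
    show "degree R e \<in> degrees R"
      using e by (simp add: degrees_eq)
  qed
  then show ?thesis
    by (simp add: m_def)
qed

lemma degree_sum_degree:
  assumes "p \<in> pointed_problems R" "q \<in> pointed_problems R"
  shows "degree_sum R (degree R p) (degree R q) = degree R (problem_sum p q)"
  unfolding degree_sum_def by (rule degree_operation[OF problem_sum_mono assms])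

lemma sum_monoid: "monoid (sum_monoid R)"
proof -
  have left: "problem_sum NoRealizer p = p" for p :: "'a obj problem"
    by (cases p) simp_all
  have "monoid \<lparr>carrier = degrees R,
      mult = (\<lambda>a b. \<Union>p \<in> a. \<Union>q \<in> b. degree R (problem_sum p q)), one = degree R NoRealizer\<rparr>"
    by (rule degree_monoid[OF problem_sum_pointed problem_sum_mono problem_sum_assoc
          pointed_problems_NoRealizer])
      (simp_all add: left weihrauch_equiv_refl)
  then show ?thesis
    unfolding sum_monoid_def zero_degree_def degree_sum_def .
qed

lemma prod_monoid: "monoid (prod_monoid R)"
proof -
  have "problem_prod (Mvf baire_identity) p \<equiv>\<^sub>W p" "problem_prod p (Mvf baire_identity) \<equiv>\<^sub>W p"
    if "p \<in> pointed_problems R" for p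
    using that
    by (elim pointed_problemsE; simp add: weihrauch_equiv_refl mvf_prod_baire_identity_left
        mvf_prod_baire_identity_right)+
  then have "monoid \<lparr>carrier = degrees R,
      mult = (\<lambda>a b. \<Union>p \<in> a. \<Union>q \<in> b. degree R (problem_prod p q)),
      one = degree R (Mvf baire_identity)\<rparr>"
    by (intro degree_monoid[OF problem_prod_pointed problem_prod_mono problem_prod_assoc
          baire_identity_pointed])
  then show ?thesis
    unfolding prod_monoid_def one_degree_eq degree_prod_def .
qed

lemma degree_order_simps [simp]:
  "carrier (degree_order R) = degrees R"
  "eq (degree_order R) = (=)"
  "le (degree_order R) = degree_le"
  by (simp_all add: degree_order_def)

lemma degree_order_partial_order: "partial_order (degree_order R)"
proof unfold_locales
  fix a b c
  assume "a \<in> carrier (degree_order R)" "b \<in> carrier (degree_order R)"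
    "c \<in> carrier (degree_order R)"
    and "le (degree_order R) a b" "le (degree_order R) b c"
  then show "le (degree_order R) a c"
    using weihrauch_le_trans by (fastforce simp: degrees_eq degree_le_iff)
next
  fix a b
  assume "le (degree_order R) a b" "le (degree_order R) b a"
    and "a \<in> carrier (degree_order R)" "b \<in> carrier (degree_order R)"
  then have "a = b"
    unfolding degree_order_simps degrees_eq
    by (elim imageE, hypsubst) (rule degree_cong, simp add: degree_le_iff weihrauch_equiv_def)
  then show "eq (degree_order R) a b"
    by simp
qed (auto simp: degrees_eq degree_le_iff weihrauch_le_refl)

lemma degree_sum_is_glb:
  assumes "a \<in> degrees R" "b \<in> degrees R"
  shows "is_glb (degree_order R) (degree_sum R a b) {a, b}"
proof -
  obtain p q where pq: "p \<in> pointed_problems R" "q \<in> pointed_problems R"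
    and ab: "a = degree R p" "b = degree R q"
    using assms by (auto simp: degrees_eq)
  show ?thesis
  proof (rule greatest_LowerI)
    show "{a, b} \<subseteq> carrier (degree_order R)"
      using assms by simp
    show "degree_sum R a b \<in> carrier (degree_order R)"
      using pq by (simp add: ab degree_sum_degree degrees_eq problem_sum_pointed)
    show "le (degree_order R) (degree_sum R a b) c" if "c \<in> {a, b}" for c
      using that pq
      by (auto simp: ab degree_sum_degree degree_le_iff problem_sum_pointed problem_sum_lower)
  next
    fix c assume c: "c \<in> Lower (degree_order R) {a, b}"
    then obtain r where r: "c = degree R r" "r \<in> pointed_problems R"
      unfolding Lower_def degree_order_simps degrees_eq by blast
    have "degree_le c a" "degree_le c b"
      using c assms by (simp_all add: Lower_def)
    then show "le (degree_order R) c (degree_sum R a b)"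
      using pq r by (simp add: ab degree_sum_degree degree_le_iff problem_sum_pointed
          problem_sum_greatest)
  qed
qed

lemma degree_order_lower_semilattice: "lower_semilattice (degree_order R)"
proof -
  interpret partial_order "degree_order R"
    by (rule degree_order_partial_order)
  show ?thesis
    by unfold_locales (use degree_sum_is_glb in auto)
qed

lemma degree_sum_idem:
  assumes "a \<in> degrees R"
  shows "degree_sum R a a = a"
proof -
  obtain p where p: "a = degree R p" "p \<in> pointed_problems R"
    using assms unfolding degrees_eq by blast
  have "problem_sum p p \<equiv>\<^sub>W p"
    using problem_sum_lower(1)[OF p(2) p(2)] problem_sum_greatest[OF p(2) p(2) p(2)]
    by (simp add: weihrauch_le_refl weihrauch_equiv_def)
  then show ?thesis
    using p by (simp add: degree_sum_degree degree_cong)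
qed

lemma one_degree_least: "least (degree_order R) (one_degree R) (degrees R)"
  by (auto simp: least_def one_degree_eq degrees_eq degree_le_iff baire_identity_pointed
      baire_identity_least)

lemma zero_degree_greatest: "greatest (degree_order R) (zero_degree R) (degrees R)"
  by (auto simp: greatest_def zero_degree_def degrees_eq degree_le_iff
      pointed_problems_NoRealizer weihrauch_le_NoRealizer)

end

theorem theorem3p14:
  fixes R :: "'a obj repspace set"
  assumes "\<forall>X \<in> R. represented_space X"
    and "baire_space \<in> R"
    and "\<forall>X \<in> R. \<forall>Y \<in> R. prod_space X Y \<in> R"
    and "\<forall>X \<in> R. \<forall>Y \<in> R. sum_space X Y \<in> R"
  shows "lower_semilattice (degree_order R)
    \<and> least (degree_order R) (one_degree R) (degrees R)
    \<and> greatest (degree_order R) (zero_degree R) (degrees R)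
    \<and> (\<forall>a \<in> degrees R. \<forall>b \<in> degrees R. is_glb (degree_order R) (degree_sum R a b) {a, b})
    \<and> monoid (sum_monoid R)
    \<and> (\<forall>a \<in> degrees R. degree_sum R a a = a)
    \<and> monoid (prod_monoid R)"
proof -
  interpret weihrauch_universe R
    using assms by unfold_locales auto
  show ?thesis
    using degree_order_lower_semilattice one_degree_least zero_degree_greatest
      degree_sum_is_glb sum_monoid degree_sum_idem prod_monoid
    by blast
qed

end
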